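(* Let $K$ be a field, $L=L_0\oplus L_1$ a (left) Leibniz superalgebra over $K$ and $M=M_0\oplus M_1$ a module over $L$. Then $\delta\circ\delta=0$, i.e. $\delta^{n+1}\circ\delta^{n}=0$ for all $n\ge 0$; that is, $(C^{*}(L;M),\delta)$ is a cochain complex.
   Context: Fix a field $K$. In a $\mathbb{Z}_2$-graded space, a homogeneous element appearing in an exponent of $-1$ stands for its degree: $(-1)^{ab}=(-1)^{\deg(a)\deg(b)}$; likewise $f$ in an exponent stands for $\deg(f)$. Formulas with such signs are stated for homogeneous arguments and extended (multi)linearly. A (left) Leibniz superalgebra is a $\mathbb{Z}_2$-graded $K$-vector space $L=L_0\oplus L_1$ with a bilinear map $[-,-]:L\times L\to L$ such that $[L_\alpha,L_\beta]\subseteq L_{\alpha+\beta}$ and $[[a,b],c]=[a,[b,c]]-(-1)^{ab}[b,[a,c]]$ for all homogeneous $a,b,c\in L$. A module over $L$ is a $\mathbb{Z}_2$-graded $K$-vector space $M=M_0\oplus M_1$ with two bilinear maps $[-,-]:L\times M\to M$ and $[-,-]:M\times L\to M$ satisfying $[L_\alpha,M_\beta]\subseteq M_{\alpha+\beta}$, $[M_\beta,L_\alpha]\subseteq M_{\alpha+\beta}$, and for all homogeneous $a,b\in L$, $m\in M$: (1) $[[a,b],m]=[a,[b,m]]-(-1)^{ab}[b,[a,m]]$; (2) $[[a,m],b]=[a,[m,b]]-(-1)^{am}[m,[a,b]]$; (3) $[[m,a],b]=[m,[a,b]]-(-1)^{ma}[a,[m,b]]$. For $n\ge1$, an $n$-linear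 map $f:L\times\cdots\times L\to M$ is homogeneous of degree $\alpha\in\mathbb{Z}_2$ if $\deg f(x_1,\dots,x_n)-\sum_i\deg(x_i)=\alpha$ for all homogeneous $x_i\in L$. $C^n_\alpha(L;M)$ is the space of homogeneous $n$-linear maps of degree $\alpha$, $C^n(L;M)=C^n_0(L;M)\oplus C^n_1(L;M)$, and $C^0(L;M)=M$ (with its grading). The $K$-linear maps $\delta^n:C^n(L;M)\to C^{n+1}(L;M)$ (all written $\delta$) are defined by $\delta^0 f(x_1)=-[f,x_1]$ for $f\in M$, and for $n\ge1$, homogeneous $f\in C^n(L;M)$ and homogeneous $x_i\in L$, $$\begin{aligned}\delta^n f(x_1,\dots,x_{n+1})={}&\sum_{1\le i<j\le n+1}(-1)^{i+x_i(x_{i+1}+\cdots+x_{j-1})}f(x_1,\dots,x_{i-1},x_{i+1},\dots,x_{j-1},[x_i,x_j],x_{j+1},\dots,x_{n+1})\\&+\sum_{i=1}^{n}(-1)^{i+1+x_i(f+x_1+\cdots+x_{i-1})}[x_i,f(x_1,\dots,x_{i-1},x_{i+1},\dots,x_{n+1})]\\&+(-1)^{n+1}[f(x_1,\dots,x_n),x_{n+1}].\end{aligned}$$ *)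

theory Defs
  imports Complex_Main "HOL-Library.Z2" "HOL-Library.Function_Algebras"
begin

declare add_bit_eq_xor [simp del] mult_bit_eq_and [simp del]

section \<open>Graded vector spaces\<close>

text \<open>
  Degrees are elements of \<^typ>\<open>bit\<close>, the ring of integers modulo 2. All homogeneity
  conditions below quantify over the degrees rather than applying a degree function to
  elements, because the zero vector is homogeneous of both degrees.
\<close>

text \<open>The element \<open>(-1)\<^sup>e v\<close>.\<close>

definition signed :: "bit \<Rightarrow> 'v::ab_group_add \<Rightarrow> 'v" where
  "signed e v = (if e = 0 then v else - v)"

locale graded_vector_space = vector_space scale
  for scale :: "'k::field \<Rightarrow> 'v::ab_group_add \<Rightarrow> 'v" +
  fixes V :: "bit \<Rightarrow> 'v set"
  assumes subspace_grade: "subspace (V \<alpha>)"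
    and grades_disjoint: "V 0 \<inter> V 1 = {0}"
    and grades_span: "\<exists>a\<in>V 0. \<exists>b\<in>V 1. v = a + b"

text \<open>The degree \<open>\<alpha>\<close> component of \<open>v\<close> in the direct sum of \<open>V 0\<close> and \<open>V 1\<close>.\<close>

definition component :: "(bit \<Rightarrow> 'v::ab_group_add set) \<Rightarrow> bit \<Rightarrow> 'v \<Rightarrow> 'v" where
  "component V \<alpha> v = (THE w. w \<in> V \<alpha> \<and> v - w \<in> V (\<alpha> + 1))"

definition bilinear_map ::
  "('k::field \<Rightarrow> 'a::ab_group_add \<Rightarrow> 'a) \<Rightarrow> ('k \<Rightarrow> 'b::ab_group_add \<Rightarrow> 'b)
    \<Rightarrow> ('k \<Rightarrow> 'c::ab_group_add \<Rightarrow> 'c) \<Rightarrow> ('a \<Rightarrow> 'b \<Rightarrow> 'c) \<Rightarrow> bool" where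
  "bilinear_map sA sB sC h \<longleftrightarrow>
    (\<forall>a. Vector_Spaces.linear sB sC (\<lambda>b. h a b)) \<and>
    (\<forall>b. Vector_Spaces.linear sA sC (\<lambda>a. h a b))"

section \<open>Leibniz superalgebras and their modules\<close>

locale leibniz_superalgebra = graded_vector_space scaleL L
  for scaleL :: "'k::field \<Rightarrow> 'l::ab_group_add \<Rightarrow> 'l" and L :: "bit \<Rightarrow> 'l set" +
  fixes br :: "'l \<Rightarrow> 'l \<Rightarrow> 'l"
  assumes br_bilinear: "bilinear_map scaleL scaleL scaleL br"
    and br_grade: "a \<in> L \<alpha> \<Longrightarrow> b \<in> L \<beta> \<Longrightarrow> br a b \<in> L (\<alpha> + \<beta>)"
    and leibniz: "a \<in> L \<alpha> \<Longrightarrow> b \<in> L \<beta> \<Longrightarrow> c \<in> L \<gamma> \<Longrightarrow>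
      br (br a b) c = br a (br b c) - signed (\<alpha> * \<beta>) (br b (br a c))"

text \<open>\<open>lact a m\<close> and \<open>ract m a\<close> are the brackets \<open>[a, m]\<close> and \<open>[m, a]\<close>.\<close>

locale leibniz_supermodule =
  L: leibniz_superalgebra scaleL L br + M: graded_vector_space scaleM M
  for scaleL :: "'k::field \<Rightarrow> 'l::ab_group_add \<Rightarrow> 'l" and L :: "bit \<Rightarrow> 'l set"
    and br :: "'l \<Rightarrow> 'l \<Rightarrow> 'l"
    and scaleM :: "'k \<Rightarrow> 'm::ab_group_add \<Rightarrow> 'm" and M :: "bit \<Rightarrow> 'm set" +
  fixes lact :: "'l \<Rightarrow> 'm \<Rightarrow> 'm" and ract :: "'m \<Rightarrow> 'l \<Rightarrow> 'm"
  assumes lact_bilinear: "bilinear_map scaleL scaleM scaleM lact"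
    and ract_bilinear: "bilinear_map scaleM scaleL scaleM ract"
    and lact_grade: "a \<in> L \<alpha> \<Longrightarrow> m \<in> M \<beta> \<Longrightarrow> lact a m \<in> M (\<alpha> + \<beta>)"
    and ract_grade: "a \<in> L \<alpha> \<Longrightarrow> m \<in> M \<beta> \<Longrightarrow> ract m a \<in> M (\<alpha> + \<beta>)"
    and module_LLM: "a \<in> L \<alpha> \<Longrightarrow> b \<in> L \<beta> \<Longrightarrow> m \<in> M \<mu> \<Longrightarrow>
      lact (br a b) m = lact a (lact b m) - signed (\<alpha> * \<beta>) (lact b (lact a m))"
    and module_LML: "a \<in> L \<alpha> \<Longrightarrow> b \<in> L \<beta> \<Longrightarrow> m \<in> M \<mu> \<Longrightarrow>
      ract (lact a m) b = lact a (ract m b) - signed (\<alpha> * \<mu>) (ract m (br a b))"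
    and module_MLL: "a \<in> L \<alpha> \<Longrightarrow> b \<in> L \<beta> \<Longrightarrow> m \<in> M \<mu> \<Longrightarrow>
      ract (ract m a) b = ract m (br a b) - signed (\<mu> * \<alpha>) (lact a (ract m b))"

section \<open>Cochains\<close>

text \<open>
  An \<open>n\<close>-linear map is a function on argument lists, set to \<open>0\<close> on lists of length other
  than \<open>n\<close> so that equality of functions is equality of \<open>n\<close>-linear maps. For \<open>n = 0\<close> such
  an \<open>f\<close> is determined by the arbitrary vector \<open>f []\<close>, which identifies the \<open>0\<close>-cochains
  with \<open>M\<close>.
\<close>

definition multilinear_map ::
  "('k::field \<Rightarrow> 'l::ab_group_add \<Rightarrow> 'l) \<Rightarrow> ('k \<Rightarrow> 'm::ab_group_add \<Rightarrow> 'm) \<Rightarrow> nat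
    \<Rightarrow> ('l list \<Rightarrow> 'm) \<Rightarrow> bool" where
  "multilinear_map sL sM n f \<longleftrightarrow>
    (\<forall>xs. length xs \<noteq> n \<longrightarrow> f xs = 0) \<and>
    (\<forall>xs i. length xs = n \<longrightarrow> i < n \<longrightarrow> Vector_Spaces.linear sL sM (\<lambda>v. f (xs[i := v])))"

definition hom_cochains ::
  "('k::field \<Rightarrow> 'l::ab_group_add \<Rightarrow> 'l) \<Rightarrow> (bit \<Rightarrow> 'l set)
    \<Rightarrow> ('k \<Rightarrow> 'm::ab_group_add \<Rightarrow> 'm) \<Rightarrow> (bit \<Rightarrow> 'm set)
    \<Rightarrow> nat \<Rightarrow> bit \<Rightarrow> ('l list \<Rightarrow> 'm) set" where
  "hom_cochains sL L sM M n \<alpha> = {f. multilinear_map sL sM n f \<and>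
    (\<forall>xs ds. length xs = n \<longrightarrow> length ds = n \<longrightarrow> (\<forall>i<n. xs ! i \<in> L (ds ! i)) \<longrightarrow>
      f xs \<in> M (\<alpha> + sum_list ds))}"

definition cochains ::
  "('k::field \<Rightarrow> 'l::ab_group_add \<Rightarrow> 'l) \<Rightarrow> (bit \<Rightarrow> 'l set)
    \<Rightarrow> ('k \<Rightarrow> 'm::ab_group_add \<Rightarrow> 'm) \<Rightarrow> (bit \<Rightarrow> 'm set)
    \<Rightarrow> nat \<Rightarrow> ('l list \<Rightarrow> 'm) set" where
  "cochains sL L sM M n =
    {f + g | f g. f \<in> hom_cochains sL L sM M n 0 \<and> g \<in> hom_cochains sL L sM M n 1}"

section \<open>The coboundary\<close>

text \<open>
  The defining formula for \<open>n \<ge> 1\<close>, with \<open>\<phi>\<close> the degree of \<open>f\<close> and \<open>d i\<close> the degree of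
  \<open>x i\<close>; the arguments are \<open>x 1, \<dots>, x (n + 1)\<close>.
\<close>

definition coboundary_hom ::
  "('l \<Rightarrow> 'l \<Rightarrow> 'l) \<Rightarrow> ('l \<Rightarrow> 'm \<Rightarrow> 'm) \<Rightarrow> ('m \<Rightarrow> 'l \<Rightarrow> 'm) \<Rightarrow> nat
    \<Rightarrow> bit \<Rightarrow> (nat \<Rightarrow> bit) \<Rightarrow> ('l list \<Rightarrow> 'm) \<Rightarrow> (nat \<Rightarrow> 'l) \<Rightarrow> 'm::ab_group_add" where
  "coboundary_hom br lact ract n \<phi> d f x =
    (\<Sum>i = 1..n. \<Sum>j = i+1..n+1.
      signed (of_nat i + d i * (\<Sum>k = i+1..<j. d k))
        (f (map x [1..<i] @ map x [i+1..<j] @ [br (x i) (x j)] @ map x [j+1..<n+2])))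
    + (\<Sum>i = 1..n.
      signed (of_nat (i + 1) + d i * (\<phi> + (\<Sum>k = 1..<i. d k)))
        (lact (x i) (f (map x [1..<i] @ map x [i+1..<n+2]))))
    + signed (of_nat (n + 1)) (ract (f (map x [1..<n+1])) (x (n + 1)))"

text \<open>
  For \<open>n \<ge> 1\<close> the formula is extended linearly in \<open>f\<close> and multilinearly in the arguments, by
  summing over all choices of homogeneous components; \<open>coboundary_homogeneous\<close> below shows that
  this gives back the formula on homogeneous data.
\<close>

definition coboundary ::
  "('k::field \<Rightarrow> 'l::ab_group_add \<Rightarrow> 'l) \<Rightarrow> (bit \<Rightarrow> 'l set) \<Rightarrow> ('l \<Rightarrow> 'l \<Rightarrow> 'l)
    \<Rightarrow> ('k \<Rightarrow> 'm::ab_group_add \<Rightarrow> 'm) \<Rightarrow> (bit \<Rightarrow> 'm set)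
    \<Rightarrow> ('l \<Rightarrow> 'm \<Rightarrow> 'm) \<Rightarrow> ('m \<Rightarrow> 'l \<Rightarrow> 'm)
    \<Rightarrow> nat \<Rightarrow> ('l list \<Rightarrow> 'm) \<Rightarrow> ('l list \<Rightarrow> 'm)" where
  "coboundary sL L br sM M lact ract n f = (\<lambda>xs.
    if length xs \<noteq> n + 1 then 0
    else if n = 0 then - ract (f []) (xs ! 0)
    else (\<Sum>\<phi>\<in>{0, 1}. \<Sum>ds | length ds = n + 1.
      coboundary_hom br lact ract n \<phi> (\<lambda>i. ds ! (i - 1))
        (component (hom_cochains sL L sM M n) \<phi> f)
        (\<lambda>i. component L (ds ! (i - 1)) (xs ! (i - 1)))))"

text \<open>The operations on function spaces are pointwise.\<close>

definition scale_fun :: "('k \<Rightarrow> 'm \<Rightarrow> 'm) \<Rightarrow> 'k \<Rightarrow> ('x \<Rightarrow> 'm) \<Rightarrow> ('x \<Rightarrow> 'm)" where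
  "scale_fun s c f = (\<lambda>x. s c (f x))"

definition linear_map_between ::
  "('k::field \<Rightarrow> 'a::ab_group_add \<Rightarrow> 'a) \<Rightarrow> 'a set \<Rightarrow> 'a set \<Rightarrow> ('a \<Rightarrow> 'a) \<Rightarrow> bool" where
  "linear_map_between s U W T \<longleftrightarrow>
    module.subspace s U \<and> module.subspace s W \<and> T ` U \<subseteq> W \<and>
    (\<forall>u\<in>U. \<forall>v\<in>U. T (u + v) = T u + T v) \<and>
    (\<forall>c. \<forall>u\<in>U. T (s c u) = s c (T u))"

section \<open>Agreement with the formula on homogeneous data\<close>

lemma bit_neq_iff: "(\<alpha>::bit) \<noteq> \<beta> \<longleftrightarrow> \<beta> = \<alpha> + 1"
  by (cases \<alpha>; cases \<beta>) auto

lemma component_eq: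
  assumes V0: "V 0 \<inter> V 1 = {0}"
    and diff: "\<And>\<alpha> a b. a \<in> V \<alpha> \<Longrightarrow> b \<in> V \<alpha> \<Longrightarrow> a - b \<in> V \<alpha>"
    and w: "w \<in> V \<alpha>" and r: "v - w \<in> V (\<alpha> + 1)"
  shows "component V \<alpha> v = w"
  unfolding component_def
proof (rule the_equality)
  fix w' assume w': "w' \<in> V \<alpha> \<and> v - w' \<in> V (\<alpha> + 1)"
  have "w' - w \<in> V \<alpha>" using w w' diff by blast
  moreover have "(v - w) - (v - w') \<in> V (\<alpha> + 1)" using r w' diff by blast
  then have "w' - w \<in> V (\<alpha> + 1)" by simp
  ultimately have "w' - w \<in> V 0 \<inter> V 1" by (cases \<alpha>) auto
  then show "w' = w" using V0 by auto
qed (use w r in auto)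

lemma component_homogeneous:
  assumes V0: "V 0 \<inter> V 1 = {0}"
    and diff: "\<And>\<alpha> a b. a \<in> V \<alpha> \<Longrightarrow> b \<in> V \<alpha> \<Longrightarrow> a - b \<in> V \<alpha>"
    and v: "v \<in> V \<alpha>"
  shows "component V \<beta> v = (if \<beta> = \<alpha> then v else 0)"
proof -
  have z: "0 \<in> V \<gamma>" for \<gamma> using V0 by (cases \<gamma>) auto
  show ?thesis
  proof (cases "\<beta> = \<alpha>")
    case True
    then show ?thesis using component_eq[OF V0 diff, of v \<alpha> v] v z by simp
  next
    case False
    then have "\<alpha> = \<beta> + 1" using bit_neq_iff by blast
    then show ?thesis using component_eq[OF V0 diff, of 0 \<beta> v] v z False by simp
  qed
qed

lemma multilinear_map_zero_arg:
  assumes "multilinear_map sL sM n f" "0 \<in> set xs"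
  shows "f xs = 0"
proof (cases "length xs = n")
  case True
  obtain i where i: "i < length xs" "xs ! i = 0" using assms(2) by (metis in_set_conv_nth)
  then have "Vector_Spaces.linear sL sM (\<lambda>v. f (xs[i := v]))"
    using assms(1) True by (auto simp: multilinear_map_def)
  then have "f (xs[i := 0]) = 0"
    using module_hom.zero[OF Vector_Spaces.linear.axioms(3)] by blast
  then show ?thesis using i by (metis list_update_id)
qed (use assms in \<open>auto simp: multilinear_map_def\<close>)

lemma bilinear_map_zero:
  assumes "bilinear_map sA sB sC h"
  shows "h 0 b = 0" "h a 0 = 0"
  using assms module_hom.zero[OF Vector_Spaces.linear.axioms(3)] unfolding bilinear_map_def by blast+

lemma signed_zero [simp]: "signed e 0 = 0"
  by (simp add: signed_def)

context leibniz_supermodule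
begin

lemma L_diff: "a \<in> L \<alpha> \<Longrightarrow> b \<in> L \<alpha> \<Longrightarrow> a - b \<in> L \<alpha>"
  using L.subspace_diff[OF L.subspace_grade] .

lemma M_diff: "a \<in> M \<alpha> \<Longrightarrow> b \<in> M \<alpha> \<Longrightarrow> a - b \<in> M \<alpha>"
  using M.subspace_diff[OF M.subspace_grade] .

lemma multilinear_map_diff:
  assumes "multilinear_map scaleL scaleM n f" "multilinear_map scaleL scaleM n g"
  shows "multilinear_map scaleL scaleM n (f - g)"
  using assms
  by (auto simp: multilinear_map_def Vector_Spaces.linear_iff fun_diff_def M.scale_right_diff_distrib)

lemma hom_cochains_diff:
  assumes "f \<in> hom_cochains scaleL L scaleM M n \<alpha>" "g \<in> hom_cochains scaleL L scaleM M n \<alpha>"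
  shows "f - g \<in> hom_cochains scaleL L scaleM M n \<alpha>"
  using assms M_diff multilinear_map_diff unfolding hom_cochains_def by auto

lemma hom_cochains_zero: "0 \<in> hom_cochains scaleL L scaleM M n \<alpha>"
  unfolding hom_cochains_def multilinear_map_def
  by (auto simp: Vector_Spaces.linear_iff L.vector_space_axioms M.vector_space_axioms
      M.subspace_0[OF M.subspace_grade])

lemma multilinear_eq_0:
  assumes f: "multilinear_map scaleL scaleM n f"
    and z: "\<And>xs ds. length xs = n \<Longrightarrow> length ds = n \<Longrightarrow> \<forall>i<n. xs ! i \<in> L (ds ! i) \<Longrightarrow> f xs = 0"
  shows "f = 0"
proof -
  have main: "f xs = 0"
    if "k \<le> n" "length xs = n" "length ds = n" "\<forall>i<n. k \<le> i \<longrightarrow> xs ! i \<in> L (ds ! i)" for k xs ds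
    using that
  proof (induction k arbitrary: xs ds)
    case 0
    then show ?case using z by auto
  next
    case (Suc k)
    obtain a b where ab: "a \<in> L 0" "b \<in> L 1" "xs ! k = a + b"
      using L.grades_span by blast
    have lin: "Vector_Spaces.linear scaleL scaleM (\<lambda>v. f (xs[k := v]))"
      using f Suc.prems by (auto simp: multilinear_map_def)
    have h: "f (xs[k := c]) = 0" if "c \<in> L \<gamma>" for c \<gamma>
      by (rule Suc.IH[where ds="ds[k := \<gamma>]"]) (use Suc.prems that in \<open>auto simp: nth_list_update\<close>)
    have "f xs = f (xs[k := a + b])" using ab by (metis list_update_id)
    also have "\<dots> = f (xs[k := a]) + f (xs[k := b])"
      using module_hom.add[OF Vector_Spaces.linear.axioms(3)[OF lin]] .
    finally show ?case using h ab by simp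
  qed
  have "f xs = 0" for xs
  proof (cases "length xs = n")
    case True
    then show ?thesis using main[of n xs "replicate n 0"] by simp
  qed (use f in \<open>auto simp: multilinear_map_def\<close>)
  then show ?thesis by (simp add: fun_eq_iff)
qed

lemma hom_cochains_disjoint:
  "hom_cochains scaleL L scaleM M n 0 \<inter> hom_cochains scaleL L scaleM M n 1 = {0}"
proof -
  have "f = 0" if f: "f \<in> hom_cochains scaleL L scaleM M n 0"
    and g: "f \<in> hom_cochains scaleL L scaleM M n 1" for f
  proof (rule multilinear_eq_0[of n])
    show "multilinear_map scaleL scaleM n f" using f by (simp add: hom_cochains_def)
    fix xs ds assume *: "length xs = n" "length ds = n" "\<forall>i<n. xs ! i \<in> L (ds ! i)"
    have "f xs \<in> M (0 + sum_list ds)" "f xs \<in> M (1 + sum_list ds)"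
      using f g * unfolding hom_cochains_def by blast+
    then have "f xs \<in> M 0 \<inter> M 1" by (cases "sum_list ds") auto
    then show "f xs = 0" using M.grades_disjoint by simp
  qed
  then show ?thesis using hom_cochains_zero by auto
qed

lemma coboundary_hom_zero_fun: "coboundary_hom br lact ract n \<phi> d 0 x = 0"
  unfolding coboundary_hom_def
  by (simp add: bilinear_map_zero[OF lact_bilinear] bilinear_map_zero[OF ract_bilinear])

lemma coboundary_hom_zero_arg:
  assumes f: "multilinear_map scaleL scaleM n f" and p: "1 \<le> p" "p \<le> n + 1" "x p = 0"
  shows "coboundary_hom br lact ract n \<phi> d f x = 0"
proof -
  note z = multilinear_map_zero_arg[OF f]
  have x0: "0 \<in> x ` A" if "p \<in> A" for A using p(3) that by (metis imageI)
  have 1: "f (map x [1..<i] @ map x [i+1..<j] @ [br (x i) (x j)] @ map x [j+1..<n+2]) = 0"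
    if "i \<in> {1..n}" "j \<in> {i+1..n+1}" for i j
  proof (rule z)
    consider "p = i" | "p = j" | "p \<in> {1..<i}" | "p \<in> {i+1..<j}" | "p \<in> {j+1..<n+2}"
      using p by fastforce
    then show "0 \<in> set (map x [1..<i] @ map x [i+1..<j] @ [br (x i) (x j)] @ map x [j+1..<n+2])"
    proof cases
      case 3 then show ?thesis using x0[of "{1..<i}"] by (simp del: upt_Suc)
    next
      case 4 then show ?thesis using x0[of "{i+1..<j}"] by (simp del: upt_Suc)
    next
      case 5 then show ?thesis using x0[of "{j+1..<n+2}"] by (simp del: upt_Suc)
    qed (use p(3) in \<open>simp_all add: bilinear_map_zero[OF L.br_bilinear]\<close>)
  qed
  have 2: "lact (x i) (f (map x [1..<i] @ map x [i+1..<n+2])) = 0" if "i \<in> {1..n}" for i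
  proof (cases "p = i")
    case True
    then show ?thesis using p(3) by (simp add: bilinear_map_zero[OF lact_bilinear])
  next
    case False
    then have "p \<in> {1..<i} \<or> p \<in> {i+1..<n+2}" using p by auto
    then have "0 \<in> set (map x [1..<i] @ map x [i+1..<n+2])"
      using x0[of "{1..<i}"] x0[of "{i+1..<n+2}"] by (auto simp del: upt_Suc)
    then show ?thesis using z by (simp add: bilinear_map_zero[OF lact_bilinear])
  qed
  have 3: "ract (f (map x [1..<n+1])) (x (n + 1)) = 0"
  proof (cases "p = n + 1")
    case True
    then show ?thesis using p(3) by (simp add: bilinear_map_zero[OF ract_bilinear])
  next
    case False
    then have "0 \<in> set (map x [1..<n+1])" using x0[of "{1..<n+1}"] p by (auto simp del: upt_Suc)
    then show ?thesis using z by (simp add: bilinear_map_zero[OF ract_bilinear])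
  qed
  show ?thesis unfolding coboundary_hom_def
    using 1 2 3 by (simp add: sum.neutral del: upt_Suc)
qed

lemma coboundary_hom_cong:
  assumes "\<And>i. 1 \<le> i \<Longrightarrow> i \<le> n + 1 \<Longrightarrow> x i = y i"
  shows "coboundary_hom br lact ract n \<phi> d f x = coboundary_hom br lact ract n \<phi> d f y"
proof -
  have m: "map x [a..<b] = map y [a..<b]" if "1 \<le> a" "b \<le> n + 2" for a b
    using assms that by auto
  show ?thesis unfolding coboundary_hom_def
    by (intro arg_cong2[where f="(+)"] sum.cong refl)
      (auto simp: m assms simp del: upt_Suc)
qed

theorem coboundary_homogeneous:
  assumes n: "1 \<le> n" and f: "f \<in> hom_cochains scaleL L scaleM M n \<phi>"
    and len: "length xs = n + 1" "length ds = n + 1"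
    and x: "\<forall>i<n+1. xs ! i \<in> L (ds ! i)"
  shows "coboundary scaleL L br scaleM M lact ract n f xs =
    coboundary_hom br lact ract n \<phi> (\<lambda>i. ds ! (i - 1)) f (\<lambda>i. xs ! (i - 1))"
proof -
  let ?C = "hom_cochains scaleL L scaleM M n"
  let ?t = "\<lambda>\<psi> es. coboundary_hom br lact ract n \<psi> (\<lambda>i. es ! (i - 1)) (component ?C \<psi> f)
        (\<lambda>i. component L (es ! (i - 1)) (xs ! (i - 1)))"
  have cf: "component ?C \<psi> f = (if \<psi> = \<phi> then f else 0)" for \<psi>
    by (rule component_homogeneous[OF hom_cochains_disjoint hom_cochains_diff f])
  have cx: "component L \<beta> (xs ! i) = (if \<beta> = ds ! i then xs ! i else 0)" if "i < n + 1" for \<beta> i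
    using component_homogeneous[OF L.grades_disjoint L_diff, of "xs ! i"] x that by blast
  have ml: "multilinear_map scaleL scaleM n f" using f by (simp add: hom_cochains_def)
  have fin: "finite {es :: bit list. length es = n + 1}"
  proof -
    have "{es :: bit list. length es = n + 1} \<subseteq> {es. set es \<subseteq> {0, 1} \<and> length es = n + 1}"
      using bit_not_zero_iff by blast
    then show ?thesis using finite_lists_length_eq[of "{0, 1::bit}"] finite_subset by blast
  qed
  have t: "?t \<psi> es = (if es = ds then ?t \<psi> ds else 0)" if l: "length es = n + 1" for \<psi> es
  proof (cases "es = ds \<or> \<psi> \<noteq> \<phi>")
    case True
    then show ?thesis by (auto simp: cf coboundary_hom_zero_fun)
  next
    case False
    then obtain i where i: "i < n + 1" "es ! i \<noteq> ds ! i" using l len by (metis nth_equalityI)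
    show ?thesis using False
      coboundary_hom_zero_arg[OF ml, of "i + 1" "\<lambda>i. component L (es ! (i - 1)) (xs ! (i - 1))"]
      i cx[of i "es ! i"] by (simp add: cf)
  qed
  have "(\<Sum>es | length es = n + 1. ?t \<psi> es) = ?t \<psi> ds" for \<psi>
  proof -
    have "(\<Sum>es | length es = n + 1. ?t \<psi> es)
        = (\<Sum>es | length es = n + 1. if es = ds then ?t \<psi> ds else 0)"
      by (rule sum.cong[OF refl]) (use t in blast)
    then show ?thesis using fin len by simp
  qed
  then have "coboundary scaleL L br scaleM M lact ract n f xs = (\<Sum>\<psi>\<in>{0, 1}. ?t \<psi> ds)"
    using n len by (simp add: coboundary_def)
  also have "\<dots> = ?t \<phi> ds"
    by (cases \<phi>) (simp_all add: cf coboundary_hom_zero_fun)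
  also have "\<dots> = coboundary_hom br lact ract n \<phi> (\<lambda>i. ds ! (i - 1)) f (\<lambda>i. xs ! (i - 1))"
    unfolding cf by simp (rule coboundary_hom_cong, use cx in auto)
  finally show ?thesis .
qed

end

end

theory Submission
  imports Defs
begin

text \<open>
  The proof is the Cartan calculus of the Loday complex. For \<open>p\<close> in \<open>L\<close> let \<open>\<iota>\<^sub>p\<close> insert \<open>p\<close>
  as the first argument, and let \<open>\<theta>\<^sub>p\<close> be the action of \<open>p\<close> on cochains. The summands of
  \<open>\<delta> f\<close> with \<open>i = 1\<close> are exactly \<open>\<theta>\<close> of the first argument, and those with \<open>i > 1\<close> form the
  coboundary of \<open>f\<close> with its first argument held fixed, up to sign. This is Cartan's formula
  \<open>\<iota>\<^sub>p \<delta> = \<theta>\<^sub>p - \<delta> \<iota>\<^sub>p\<close>, valid when at least one argument remains after \<open>p\<close>.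

  Three identities then follow, each by induction on the number of arguments:
  \<^item> \<open>\<theta>\<close> represents the bracket (\<open>lie_graded_bracket\<close>); the inductive step is the Leibniz identity
    of \<open>L\<close> inside an argument, and the case without arguments is \<open>module_LLM\<close>;
  \<^item> \<open>\<theta>\<^sub>p\<close> commutes with \<open>\<delta>\<close> (\<open>lie_cobd\<close>); the inductive step is the previous identity, and
    the case of one argument is \<open>module_LML\<close>;
  \<^item> \<open>\<delta> \<delta> = 0\<close> (\<open>cobd_cobd\<close>); the inductive step is
    \<open>\<iota>\<^sub>p \<delta> \<delta> = \<theta>\<^sub>p \<delta> - \<delta> (\<theta>\<^sub>p - \<delta> \<iota>\<^sub>p) = \<delta> \<delta> \<iota>\<^sub>p\<close>, and the case of two arguments is
    \<open>module_MLL\<close>.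

  To keep the signs under control, an argument is carried together with a degree, so that a
  cochain is a function on lists of pairs \<open>(x, e)\<close>. Then \<open>\<theta>\<close> and \<open>\<delta>\<close> have recursive definitions
  (\<open>lie\<close> and \<open>cobd\<close>) in which the accumulated signs of the double sum
  appear one factor at a time. That \<open>cobd\<close> is the alternating double sum is \<open>coboundary_hom_eq_cobd\<close>. The
  coboundary of an arbitrary cochain is obtained from it by summing over homogeneous components
  (\<open>coboundary_expand\<close>), which makes linearity in the cochain and in each argument visible.
\<close>

section \<open>Sign and linearity rules\<close>

lemma signed_add: "signed e (u + v) = signed e u + signed e v"
  by (simp add: signed_def)

lemma signed_diff: "signed e (u - v) = signed e u - signed e v"
  by (simp add: signed_def)

lemma signed_signed: "signed e (signed e' v) = signed (e + e') v"
  by (cases e; cases e') (auto simp: signed_def)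

lemma signed_one_add: "signed (1 + e) v = - signed e v"
  by (cases e) (auto simp: signed_def)

lemma signed_sum: "signed e (sum g A) = (\<Sum>a\<in>A. signed e (g a))"
  by (simp add: signed_def sum_negf)

context leibniz_supermodule
begin

lemma bilinear_lincomb:
  assumes "bilinear_map sA sB sC h"
  shows "h (sA c u + sA c' v) w = sC c (h u w) + sC c' (h v w)"
    and "h z (sB c x + sB c' y) = sC c (h z x) + sC c' (h z y)"
  using assms by (auto simp: bilinear_map_def Vector_Spaces.linear_iff)

lemmas br_lincomb = bilinear_lincomb[OF L.br_bilinear]
lemmas lact_lincomb = bilinear_lincomb[OF lact_bilinear]
lemmas ract_lincomb = bilinear_lincomb[OF ract_bilinear]

lemma signed_scaleM: "signed e (scaleM c v) = scaleM c (signed e v)"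
  by (simp add: signed_def)

lemma ract_uminus: "ract (- m) x = - ract m x"
  using ract_lincomb(1)[of "-1" m 0 m x] by simp

lemma lact_uminus: "lact x (- m) = - lact x m"
  using lact_lincomb(2)[of x "-1" m 0 m] by simp

lemma signed_in_M: "v \<in> M \<alpha> \<Longrightarrow> signed e v \<in> M \<alpha>"
  using M.subspace_neg[OF M.subspace_grade] by (simp add: signed_def)

section \<open>Cochains on arguments with degrees\<close>

definition graded_bracket :: "'l \<times> bit \<Rightarrow> 'l \<times> bit \<Rightarrow> 'l \<times> bit" where
  "graded_bracket p q = (br (fst p) (fst q), snd p + snd q)"

definition homogeneous_list :: "('l \<times> bit) list \<Rightarrow> bool" where
  "homogeneous_list ps \<longleftrightarrow> (\<forall>p\<in>set ps. fst p \<in> L (snd p))"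

lemma homogeneous_list_simps [simp]:
  "homogeneous_list []"
  "homogeneous_list (p # ps) \<longleftrightarrow> fst p \<in> L (snd p) \<and> homogeneous_list ps"
  by (auto simp: homogeneous_list_def)

lemma graded_bracket_homogeneous [simp]:
  "fst p \<in> L (snd p) \<Longrightarrow> fst q \<in> L (snd q) \<Longrightarrow>
    fst (graded_bracket p q) \<in> L (snd p + snd q)"
  by (simp add: graded_bracket_def L.br_grade)

lemma snd_graded_bracket [simp]: "snd (graded_bracket p q) = snd p + snd q"
  by (simp add: graded_bracket_def)

definition homogeneous_fun :: "bit \<Rightarrow> (('l \<times> bit) list \<Rightarrow> 'm) \<Rightarrow> bool" where
  "homogeneous_fun \<phi> F \<longleftrightarrow>
    (\<forall>ps. homogeneous_list ps \<longrightarrow> F ps \<in> M (\<phi> + sum_list (map snd ps)))"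

text \<open>
  There is no bound on the length of the list here or in \<open>homogeneous_fun\<close>: a cochain vanishes on
  lists of the wrong length, and so the arity need not be tracked.
\<close>

definition slotwise_linear :: "(('l \<times> bit) list \<Rightarrow> 'm) \<Rightarrow> bool" where
  "slotwise_linear F \<longleftrightarrow> (\<forall>ps qs e c c' u v.
    F (ps @ (scaleL c u + scaleL c' v, e) # qs)
      = scaleM c (F (ps @ (u, e) # qs)) + scaleM c' (F (ps @ (v, e) # qs)))"

section \<open>The recursive Lie derivative and coboundary\<close>

text \<open>
  The action \<open>\<theta>\<^sub>p\<close> on functions of degree \<open>\<phi>\<close>. Moving \<open>p\<close> past a first argument \<open>q\<close> costs the
  sign \<open>(-1)\<^bsup>pq\<^esup>\<close>, and \<open>F\<close> with \<open>q\<close> inserted has degree \<open>\<phi> + deg q\<close>; the two contributions of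
  \<open>deg q\<close> to the sign of the module action cancel, which leaves \<open>(-1)\<^bsup>p\<phi>\<^esup>\<close>.
\<close>

fun lie :: "bit \<Rightarrow> 'l \<times> bit \<Rightarrow> (('l \<times> bit) list \<Rightarrow> 'm) \<Rightarrow> ('l \<times> bit) list \<Rightarrow> 'm" where
  "lie \<phi> p F [] = signed (snd p * \<phi>) (lact (fst p) (F []))"
| "lie \<phi> p F (q # qs) = signed (snd p * snd q) (lie (\<phi> + snd q) p (\<lambda>rs. F (q # rs)) qs)
    - F (graded_bracket p q # qs)"

text \<open>
  Cartan's formula as a definition. A single argument is treated apart because \<open>\<delta>\<^sup>0\<close> involves the
  right action only, whereas \<open>lie\<close> at the empty list is the left action.
\<close>

fun cobd :: "bit \<Rightarrow> (('l \<times> bit) list \<Rightarrow> 'm) \<Rightarrow> ('l \<times> bit) list \<Rightarrow> 'm" where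
  "cobd \<phi> F [] = 0"
| "cobd \<phi> F [p] = - ract (F []) (fst p)"
| "cobd \<phi> F (p # q # qs) = lie \<phi> p F (q # qs) - cobd (\<phi> + snd p) (\<lambda>rs. F (p # rs)) (q # qs)"

lemma cobd_Cons: "ps \<noteq> [] \<Longrightarrow>
    cobd \<phi> F (p # ps) = lie \<phi> p F ps - cobd (\<phi> + snd p) (\<lambda>rs. F (p # rs)) ps"
  by (cases ps) auto

lemma lie_lincomb:
  "lie \<phi> p (\<lambda>rs. scaleM c (F rs) + scaleM c' (G rs)) qs
    = scaleM c (lie \<phi> p F qs) + scaleM c' (lie \<phi> p G qs)"
  by (induction qs arbitrary: \<phi> F G)
    (simp_all add: lact_lincomb signed_add signed_scaleM M.scale_right_diff_distrib)

lemma lie_diff: "lie \<phi> p (\<lambda>rs. F rs - G rs) qs = lie \<phi> p F qs - lie \<phi> p G qs"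
  using lie_lincomb[of \<phi> p 1 F "-1" G] by simp

lemma lie_signed: "lie \<phi> p (\<lambda>rs. signed e (F rs)) qs = signed e (lie \<phi> p F qs)"
  using lie_lincomb[of \<phi> p "-1" F 0 F] by (simp add: signed_def)

lemma cobd_lincomb:
  "cobd \<phi> (\<lambda>rs. scaleM c (F rs) + scaleM c' (G rs)) qs
    = scaleM c (cobd \<phi> F qs) + scaleM c' (cobd \<phi> G qs)"
proof (induction qs arbitrary: \<phi> F G)
  case (Cons p qs)
  then show ?case
    by (cases "qs = []")
      (simp_all add: cobd_Cons lie_lincomb ract_lincomb M.scale_right_diff_distrib)
qed simp

lemma cobd_diff: "cobd \<phi> (\<lambda>rs. F rs - G rs) qs = cobd \<phi> F qs - cobd \<phi> G qs"
  using cobd_lincomb[of \<phi> 1 F "-1" G] by simp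

lemma cobd_signed: "cobd \<phi> (\<lambda>rs. signed e (F rs)) qs = signed e (cobd \<phi> F qs)"
  using cobd_lincomb[of \<phi> "-1" F 0 F] by (simp add: signed_def)

text \<open>
  Cartan's formula fails at the empty list, so it may be substituted under \<open>lie\<close> or \<open>cobd\<close> only
  after it is known which lengths matter: \<open>lie\<close> keeps the number of arguments, and \<open>cobd\<close> uses the
  values of \<open>F\<close> on lists that are shorter by one.
\<close>

lemma lie_cong:
  assumes "\<And>rs. homogeneous_list rs \<Longrightarrow> length rs = length qs \<Longrightarrow> F rs = G rs"
    and "fst p \<in> L (snd p)" "homogeneous_list qs"
  shows "lie \<phi> p F qs = lie \<phi> p G qs"
  using assms
proof (induction qs arbitrary: \<phi> F G)
  case (Cons q qs)
  have "lie (\<phi> + snd q) p (\<lambda>rs. F (q # rs)) qs = lie (\<phi> + snd q) p (\<lambda>rs. G (q # rs)) qs"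
    by (rule Cons.IH) (use Cons.prems in auto)
  then show ?case using Cons.prems by simp
qed simp

lemma cobd_cong:
  assumes "\<And>rs. homogeneous_list rs \<Longrightarrow> length qs = Suc (length rs) \<Longrightarrow> F rs = G rs"
    and "homogeneous_list qs"
  shows "cobd \<phi> F qs = cobd \<phi> G qs"
  using assms
proof (induction qs arbitrary: \<phi> F G)
  case (Cons p qs)
  show ?case
  proof (cases "qs = []")
    case False
    have "cobd (\<phi> + snd p) (\<lambda>rs. F (p # rs)) qs = cobd (\<phi> + snd p) (\<lambda>rs. G (p # rs)) qs"
      by (rule Cons.IH) (use Cons.prems in auto)
    moreover have "lie \<phi> p F qs = lie \<phi> p G qs"
      by (rule lie_cong) (use Cons.prems in auto)
    ultimately show ?thesis using False by (simp add: cobd_Cons)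
  qed (use Cons.prems in simp)
qed simp

lemma homogeneous_fun_contract:
  "homogeneous_fun \<phi> F \<Longrightarrow> fst q \<in> L (snd q) \<Longrightarrow>
    homogeneous_fun (\<phi> + snd q) (\<lambda>rs. F (q # rs))"
  unfolding homogeneous_fun_def
  by (metis (no_types, lifting) add.assoc homogeneous_list_simps(2) list.simps(9) sum_list.Cons)

lemma slotwise_linear_contract: "slotwise_linear F \<Longrightarrow> slotwise_linear (\<lambda>rs. F (q # rs))"
  unfolding slotwise_linear_def by (metis append_Cons)

lemma slotwise_linear_hd:
  "slotwise_linear F \<Longrightarrow> F ((scaleL c u + scaleL c' v, e) # qs)
    = scaleM c (F ((u, e) # qs)) + scaleM c' (F ((v, e) # qs))"
  unfolding slotwise_linear_def by (metis append_Nil)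

lemma homogeneous_fun_Nil: "homogeneous_fun \<phi> F \<Longrightarrow> F [] \<in> M \<phi>"
  unfolding homogeneous_fun_def by (metis add.right_neutral homogeneous_list_simps(1) list.simps(8) sum_list.Nil)

section \<open>The Cartan identities\<close>

text \<open>
  The right-hand side is \<open>(-1)\<^bsup>xy\<^esup>\<close> times the usual supercommutator, because \<open>lie \<phi> p\<close> is
  \<open>(-1)\<^bsup>p\<phi>\<^esup>\<close> times the usual action, and the operator that is applied second meets a function whose
  degree includes that of the first. Comparing both sides at \<open>q # qs\<close>, the terms in which
  only one of \<open>x\<close>, \<open>y\<close> meets \<open>q\<close> cancel; those in which neither does are the induction hypothesis
  for \<open>F\<close> with \<open>q\<close> inserted, and those in which both do are the Leibniz identity for \<open>x\<close>, \<open>y\<close>, \<open>q\<close>.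
\<close>

lemma lie_graded_bracket:
  assumes "homogeneous_fun \<phi> F" "slotwise_linear F"
    and "fst x \<in> L (snd x)" "fst y \<in> L (snd y)" "homogeneous_list qs"
  shows "lie \<phi> (graded_bracket x y) F qs
    = signed (snd x * snd y) (lie (\<phi> + snd y) x (lie \<phi> y F) qs)
      - lie (\<phi> + snd x) y (lie \<phi> x F) qs"
  using assms
proof (induction qs arbitrary: \<phi> F)
  case Nil
  then have "F [] \<in> M \<phi>" by (simp add: homogeneous_fun_Nil)
  from module_LLM[OF Nil(3,4) this] show ?case
    by (cases "snd x"; cases "snd y"; cases \<phi>) (simp_all add: graded_bracket_def signed_def lact_uminus)
next
  case (Cons q qs)
  let ?F = "\<lambda>rs. F (q # rs)"
  have IH: "lie (\<phi> + snd q) (graded_bracket x y) ?F qs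
    = signed (snd x * snd y) (lie (\<phi> + snd q + snd y) x (lie (\<phi> + snd q) y ?F) qs)
      - lie (\<phi> + snd q + snd x) y (lie (\<phi> + snd q) x ?F) qs"
    by (rule Cons.IH) (use Cons.prems in \<open>auto intro: homogeneous_fun_contract slotwise_linear_contract\<close>)
  \<comment> \<open>The Leibniz identity is put in the form of a linear combination so that linearity of \<open>F\<close> applies.\<close>
  have "br (br (fst x) (fst y)) (fst q) = scaleL 1 (br (fst x) (br (fst y) (fst q)))
      + scaleL (if snd x * snd y = 0 then -1 else 1) (br (fst y) (br (fst x) (fst q)))"
    using L.leibniz[of "fst x" "snd x" "fst y" "snd y" "fst q" "snd q"] Cons.prems
    by (simp add: signed_def)
  then have jacobi: "F (graded_bracket (graded_bracket x y) q # qs)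
    = F (graded_bracket x (graded_bracket y q) # qs)
      - signed (snd x * snd y) (F (graded_bracket y (graded_bracket x q) # qs))"
    using slotwise_linear_hd[OF Cons.prems(2), of 1 _ 1] slotwise_linear_hd[OF Cons.prems(2), of "-1" _ 0 0]
    by (simp add: graded_bracket_def signed_def add.assoc add.left_commute[of "snd x" "snd y"])
  show ?case
    using IH jacobi
    by (simp add: lie_diff lie_signed signed_diff signed_signed)
      (cases "snd x"; cases "snd y"; cases "snd q"; simp add: signed_def add.assoc add.commute)
qed

text \<open>
  Expanding both sides at \<open>q # qs\<close> by Cartan's formula, the coboundaries cancel by the induction
  hypothesis, and what remains is the representation property for \<open>x\<close> and \<open>q\<close>. With the single
  argument \<open>q\<close> the claim is \<open>[[x,m],q] = [x,[m,q]] \<plusminus> [m,[x,q]]\<close> for the vector \<open>m = F []\<close>.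
\<close>

lemma lie_cobd:
  assumes "homogeneous_fun \<phi> F" "slotwise_linear F"
    and "fst x \<in> L (snd x)" "homogeneous_list qs"
  shows "lie \<phi> x (cobd \<phi> F) qs = cobd (\<phi> + snd x) (lie \<phi> x F) qs"
  using assms
proof (induction qs arbitrary: \<phi> F)
  case Nil
  then show ?case using lact_lincomb(2)[of "fst x" 0 0 0 0] by simp
next
  case (Cons q qs)
  show ?case
  proof (cases "qs = []")
    case True
    have "F [] \<in> M \<phi>" using Cons.prems by (simp add: homogeneous_fun_Nil)
    from module_LML[OF Cons.prems(3) _ this, of "fst q" "snd q"] Cons.prems(4) show ?thesis
      by (cases "snd x"; cases "snd q"; cases \<phi>)
        (simp_all add: True graded_bracket_def signed_def lact_uminus ract_uminus)
  next
    case False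
    let ?F = "\<lambda>rs. F (q # rs)"
    let ?s = "snd x * snd q"
    have q: "fst q \<in> L (snd q)" "homogeneous_list qs" using Cons.prems by auto
    have IH: "lie (\<phi> + snd q) x (cobd (\<phi> + snd q) ?F) qs
        = cobd (\<phi> + snd q + snd x) (lie (\<phi> + snd q) x ?F) qs"
      by (rule Cons.IH) (use Cons.prems in \<open>auto intro: homogeneous_fun_contract slotwise_linear_contract\<close>)
    have "lie (\<phi> + snd q) x (\<lambda>rs. cobd \<phi> F (q # rs)) qs
        = lie (\<phi> + snd q) x (\<lambda>rs. lie \<phi> q F rs - cobd (\<phi> + snd q) ?F rs) qs"
      by (rule lie_cong) (use False q Cons.prems in \<open>auto intro!: cobd_Cons\<close>)
    then have l: "lie \<phi> x (cobd \<phi> F) (q # qs)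
        = signed ?s (lie (\<phi> + snd q) x (lie \<phi> q F) qs - cobd (\<phi> + snd q + snd x) (lie (\<phi> + snd q) x ?F) qs)
          - (lie \<phi> (graded_bracket x q) F qs
             - cobd (\<phi> + (snd x + snd q)) (\<lambda>rs. F (graded_bracket x q # rs)) qs)"
      using False by (simp add: lie_diff IH cobd_Cons)
    have r: "cobd (\<phi> + snd x) (lie \<phi> x F) (q # qs)
        = lie (\<phi> + snd x) q (lie \<phi> x F) qs
          - (signed ?s (cobd (\<phi> + snd x + snd q) (lie (\<phi> + snd q) x ?F) qs)
             - cobd (\<phi> + snd x + snd q) (\<lambda>rs. F (graded_bracket x q # rs)) qs)"
      using False by (simp add: cobd_Cons cobd_diff cobd_signed)
    show ?thesis unfolding l r lie_graded_bracket[OF Cons.prems(1,2,3) q]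
      by (simp add: signed_diff ac_simps)
  qed
qed

text \<open>
  For at least three arguments Cartan's formula applies twice and the Lie derivatives cancel. For
  two arguments the second application is not available; there the claim is
  the identity for \<open>[[m,p],q]\<close> with \<open>m = F []\<close>.
\<close>

theorem cobd_cobd:
  assumes "homogeneous_fun \<phi> F" "slotwise_linear F" "homogeneous_list ps"
  shows "cobd \<phi> (cobd \<phi> F) ps = 0"
  using assms
proof (induction ps arbitrary: \<phi> F)
  case (Cons p ps)
  have p: "fst p \<in> L (snd p)" "homogeneous_list ps" using Cons.prems by auto
  consider "ps = []" | q where "ps = [q]" | "length ps \<ge> 2"
    by (cases ps; cases "tl ps") auto
  then show ?case
  proof cases
    case 1
    then show ?thesis by (simp add: bilinear_map_zero[OF ract_bilinear])
  next
    case (2 q)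
    have "F [] \<in> M \<phi>" using Cons.prems by (simp add: homogeneous_fun_Nil)
    from module_MLL[OF p(1) _ this, of "fst q" "snd q"] p(2) 2 show ?thesis
      by (cases "snd p"; cases \<phi>)
        (simp_all add: graded_bracket_def signed_def lact_uminus ract_uminus)
  next
    case 3
    let ?F = "\<lambda>rs. F (p # rs)"
    have IH: "cobd (\<phi> + snd p) (cobd (\<phi> + snd p) ?F) ps = 0"
      by (rule Cons.IH) (use Cons.prems in \<open>auto intro: homogeneous_fun_contract slotwise_linear_contract\<close>)
    have "cobd (\<phi> + snd p) (\<lambda>rs. cobd \<phi> F (p # rs)) ps
        = cobd (\<phi> + snd p) (\<lambda>rs. lie \<phi> p F rs - cobd (\<phi> + snd p) ?F rs) ps"
      by (rule cobd_cong) (use 3 p in \<open>auto intro!: cobd_Cons\<close>)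
    moreover have "ps \<noteq> []" using 3 by auto
    ultimately show ?thesis
      using lie_cobd[OF Cons.prems(1,2) p] IH by (simp add: cobd_Cons cobd_diff)
  qed
qed simp

section \<open>Degree and linearity of the recursive coboundary\<close>

lemma homogeneous_fun_eq:
  "homogeneous_fun \<phi> F \<Longrightarrow> homogeneous_list ps \<Longrightarrow> \<alpha> = \<phi> + sum_list (map snd ps) \<Longrightarrow>
    F ps \<in> M \<alpha>"
  by (simp add: homogeneous_fun_def)

lemma lie_grade:
  assumes "homogeneous_fun \<phi> F" "fst p \<in> L (snd p)" "homogeneous_list qs"
  shows "lie \<phi> p F qs \<in> M (\<phi> + snd p + sum_list (map snd qs))"
  using assms
proof (induction qs arbitrary: \<phi> F)
  case Nil
  then show ?case
    using lact_grade[of "fst p" "snd p" "F []" \<phi>]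
    by (simp add: homogeneous_fun_Nil signed_in_M add.commute)
next
  case (Cons q qs)
  have "lie (\<phi> + snd q) p (\<lambda>rs. F (q # rs)) qs \<in> M (\<phi> + snd q + snd p + sum_list (map snd qs))"
    by (rule Cons.IH) (use Cons.prems in \<open>auto intro: homogeneous_fun_contract\<close>)
  moreover have "F (graded_bracket p q # qs) \<in> M (\<phi> + snd p + sum_list (map snd (q # qs)))"
    using Cons.prems by (intro homogeneous_fun_eq[OF Cons.prems(1)]) (auto simp: add.assoc)
  ultimately show ?case by (auto intro!: M_diff signed_in_M simp: ac_simps)
qed

lemma cobd_grade:
  assumes "homogeneous_fun \<phi> F" "homogeneous_list ps"
  shows "cobd \<phi> F ps \<in> M (\<phi> + sum_list (map snd ps))"
  using assms
proof (induction ps arbitrary: \<phi> F)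
  case Nil
  then show ?case by (simp add: M.subspace_0[OF M.subspace_grade])
next
  case (Cons p ps)
  show ?case
  proof (cases "ps = []")
    case True
    then show ?thesis
      using Cons.prems ract_grade[of "fst p" "snd p" "F []" \<phi>] M.subspace_neg[OF M.subspace_grade]
      by (simp add: homogeneous_fun_Nil add.commute)
  next
    case False
    have "cobd (\<phi> + snd p) (\<lambda>rs. F (p # rs)) ps \<in> M (\<phi> + snd p + sum_list (map snd ps))"
      by (rule Cons.IH) (use Cons.prems in \<open>auto intro: homogeneous_fun_contract\<close>)
    moreover have "lie \<phi> p F ps \<in> M (\<phi> + snd p + sum_list (map snd ps))"
      by (rule lie_grade) (use Cons.prems in auto)
    ultimately show ?thesis using False by (simp add: cobd_Cons M_diff add.assoc)
  qed
qed

lemma slotwise_linearD: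
  "slotwise_linear F \<Longrightarrow> F (ps @ (scaleL c u + scaleL c' v, e) # qs)
    = scaleM c (F (ps @ (u, e) # qs)) + scaleM c' (F (ps @ (v, e) # qs))"
  unfolding slotwise_linear_def by blast

lemma slotwise_linear_graded_bracket:
  assumes "slotwise_linear F"
  shows "F (graded_bracket (scaleL c u + scaleL c' v, e) q # qs)
      = scaleM c (F (graded_bracket (u, e) q # qs)) + scaleM c' (F (graded_bracket (v, e) q # qs))"
    and "F (graded_bracket p (scaleL c u + scaleL c' v, e) # qs)
      = scaleM c (F (graded_bracket p (u, e) # qs)) + scaleM c' (F (graded_bracket p (v, e) # qs))"
  using slotwise_linear_hd[OF assms] by (simp_all add: graded_bracket_def br_lincomb)

lemma lie_lincomb_direction:
  assumes "slotwise_linear F"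
  shows "lie \<phi> (scaleL c u + scaleL c' v, e) F qs
    = scaleM c (lie \<phi> (u, e) F qs) + scaleM c' (lie \<phi> (v, e) F qs)"
  using assms
proof (induction qs arbitrary: \<phi> F)
  case Nil
  then show ?case by (simp add: lact_lincomb signed_add signed_scaleM)
next
  case (Cons q qs)
  show ?case
    using Cons.IH[OF slotwise_linear_contract[OF Cons.prems]] slotwise_linear_graded_bracket[OF Cons.prems]
    by (simp add: signed_add signed_scaleM M.scale_right_diff_distrib)
qed

lemma slotwise_linear_lie:
  assumes "slotwise_linear F"
  shows "slotwise_linear (lie \<phi> p F)"
proof -
  have "lie \<phi> p F (ps @ (scaleL c u + scaleL c' v, e) # qs)
    = scaleM c (lie \<phi> p F (ps @ (u, e) # qs)) + scaleM c' (lie \<phi> p F (ps @ (v, e) # qs))"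
    for ps qs e c c' u v
    using assms
  proof (induction ps arbitrary: \<phi> F)
    case Nil
    then show ?case
      by (simp add: slotwise_linear_hd slotwise_linear_graded_bracket lie_lincomb
          signed_add signed_scaleM M.scale_right_diff_distrib)
  next
    case (Cons q ps)
    show ?case
      using Cons.IH[OF slotwise_linear_contract[OF Cons.prems]]
        slotwise_linearD[OF Cons.prems, of "graded_bracket p q # ps"]
      by (simp add: signed_add signed_scaleM M.scale_right_diff_distrib)
  qed
  then show ?thesis by (simp add: slotwise_linear_def)
qed

lemma slotwise_linear_cobd:
  assumes "slotwise_linear F"
  shows "slotwise_linear (cobd \<phi> F)"
proof -
  have "cobd \<phi> F (ps @ (scaleL c u + scaleL c' v, e) # qs)
    = scaleM c (cobd \<phi> F (ps @ (u, e) # qs)) + scaleM c' (cobd \<phi> F (ps @ (v, e) # qs))"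
    for ps qs e c c' u v
    using assms
  proof (induction ps arbitrary: \<phi> F)
    case Nil
    then show ?case
      by (cases "qs = []")
        (simp_all add: cobd_Cons slotwise_linear_hd lie_lincomb_direction cobd_lincomb ract_lincomb
          M.scale_right_diff_distrib)
  next
    case (Cons p ps)
    show ?case
      using Cons.IH[OF slotwise_linear_contract[OF Cons.prems]]
        slotwise_linearD[OF slotwise_linear_lie[OF Cons.prems]]
      by (simp add: cobd_Cons M.scale_right_diff_distrib)
  qed
  then show ?thesis by (simp add: slotwise_linear_def)
qed

section \<open>Comparison with the explicit double sum\<close>

text \<open>
  Unfolding the recursion: reaching the argument \<open>j\<close> means passing those before it, which
  gives their degrees in the sign. Index intervals are used so that the right-hand side has the shape
  of the sum over \<open>j\<close> in the defining formula.
\<close>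

lemma lie_upt:
  "lie \<phi> p F (map g [a..<b]) = signed (snd p * \<phi>) (lact (fst p) (F (map g [a..<b])))
    + (\<Sum>j = a..<b. signed (1 + snd p * (\<Sum>k = a..<j. snd (g k)))
        (F (map g [a..<j] @ graded_bracket p (g j) # map g [j+1..<b])))"
proof (induction "b - a" arbitrary: a \<phi> F)
  case 0
  then show ?case by simp
next
  case (Suc m)
  then have ab: "a < b" by simp
  have [simp]: "(\<Sum>k = a..<j. snd (g k)) = snd (g a) + (\<Sum>k = Suc a..<j. snd (g k))"
    "map g [a..<j] = g a # map g [Suc a..<j]" if "a < j" for j
    using that by (simp_all add: sum.atLeast_Suc_lessThan upt_conv_Cons)
  have IH: "lie (\<phi> + snd (g a)) p (\<lambda>rs. F (g a # rs)) (map g [Suc a..<b])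
      = signed (snd p * (\<phi> + snd (g a))) (lact (fst p) (F (g a # map g [Suc a..<b])))
    + (\<Sum>j = Suc a..<b. signed (1 + snd p * (\<Sum>k = Suc a..<j. snd (g k)))
        (F (g a # map g [Suc a..<j] @ graded_bracket p (g j) # map g [j+1..<b])))"
    by (rule Suc.hyps(1)) (use Suc.hyps(2) in simp)
  have "snd p * snd (g a) + snd p * (\<phi> + snd (g a)) = snd p * \<phi>"
    by (cases "snd p"; cases "snd (g a)"; cases \<phi>) simp_all
  moreover have "signed (snd p * snd (g a)) (\<Sum>j = Suc a..<b.
        signed (1 + snd p * (\<Sum>k = Suc a..<j. snd (g k)))
        (F (g a # map g [Suc a..<j] @ graded_bracket p (g j) # map g [j+1..<b])))
    = (\<Sum>j = Suc a..<b. signed (1 + snd p * (\<Sum>k = a..<j. snd (g k)))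
        (F (map g [a..<j] @ graded_bracket p (g j) # map g [j+1..<b])))"
    unfolding signed_sum signed_signed
    by (rule sum.cong) (auto simp: distrib_left ac_simps)
  ultimately show ?case
    using ab IH
    by (simp add: sum.atLeast_Suc_lessThan[OF ab] signed_add signed_signed signed_one_add)
      (simp add: signed_def)
qed

text \<open>
  Cartan's formula for the double sum. The summands with \<open>i = 1\<close> give the Lie derivative by
  \<open>lie_upt\<close>; in the others the shift from \<open>i\<close> to \<open>i - 1\<close> changes the sign, and in the left action
  the degree of the first argument becomes part of the degree of the contracted cochain.
\<close>

lemma coboundary_hom_Suc:
  "coboundary_hom br lact ract (Suc n) \<phi> d f x
    = lie \<phi> (x 1, d 1) (\<lambda>ps. f (map fst ps)) (map (\<lambda>i. (x (Suc i), d (Suc i))) [1..<n+2])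
      - coboundary_hom br lact ract n (\<phi> + d 1) (\<lambda>i. d (Suc i)) (\<lambda>ys. f (x 1 # ys)) (\<lambda>i. x (Suc i))"
proof -
  have m: "map x [Suc a..<Suc b] = map (\<lambda>i. x (Suc i)) [a..<b]" for a b
    by (simp add: map_Suc_upt[symmetric] del: upt_Suc)
  have m1: "map x [Suc 0..<Suc i] = x 1 # map (\<lambda>i. x (Suc i)) [1..<i]" if "1 \<le> i" for i
    using that m[of 1 i] by (simp add: upt_conv_Cons del: upt_Suc)
  have s1: "(\<Sum>k = Suc 0..<Suc i. d k) = d 1 + (\<Sum>k = 1..<i. d (Suc k))" if "1 \<le> i" for i
    using that by (simp add: sum.atLeast_Suc_lessThan sum.shift_bounds_Suc_ivl del: sum.op_ivl_Suc)
  have sum_first: "(\<Sum>i = 1..Suc n. S i) = S 1 + (\<Sum>i = 1..n. S (Suc i))" for S :: "nat \<Rightarrow> 'm"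
    unfolding sum.shift_bounds_cl_Suc_ivl[symmetric] by (rule sum.atLeast_Suc_atMost) simp
  have split_sum: "(\<Sum>i = 1..Suc n. \<Sum>j = i+1..Suc n+1. A i j)
      = (\<Sum>j = 2..n+2. A 1 j) + (\<Sum>i = 1..n. \<Sum>j = i+1..n+1. A (Suc i) (Suc j))"
    for A :: "nat \<Rightarrow> nat \<Rightarrow> 'm"
  proof -
    have shift: "(\<Sum>j = Suc i+1..Suc n+1. S j) = (\<Sum>j = i+1..n+1. S (Suc j))"
      for S :: "nat \<Rightarrow> 'm" and i
      using sum.shift_bounds_cl_Suc_ivl[of S "i+1" "n+1"] by simp
    have "1 + 1 = (2::nat)" "Suc n + 1 = n + 2" by simp_all
    then show ?thesis unfolding sum_first shift by (simp only:)
  qed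
  \<comment> \<open>\<open>?A'\<close> and \<open>?B'\<close> are the summands for the cochain with \<open>x 1\<close> inserted, on the shifted arguments.\<close>
  let ?A = "\<lambda>i j. signed (of_nat i + d i * (\<Sum>k = i+1..<j. d k))
        (f (map x [1..<i] @ map x [i+1..<j] @ [br (x i) (x j)] @ map x [j+1..<Suc n+2]))"
  let ?B = "\<lambda>i. signed (of_nat (i + 1) + d i * (\<phi> + (\<Sum>k = 1..<i. d k)))
        (lact (x i) (f (map x [1..<i] @ map x [i+1..<Suc n+2])))"
  let ?A' = "\<lambda>i j. signed (of_nat i + d (Suc i) * (\<Sum>k = i+1..<j. d (Suc k)))
        (f (x 1 # map (\<lambda>i. x (Suc i)) [1..<i] @ map (\<lambda>i. x (Suc i)) [i+1..<j] @
          [br (x (Suc i)) (x (Suc j))] @ map (\<lambda>i. x (Suc i)) [j+1..<n+2]))"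
  let ?B' = "\<lambda>i. signed (of_nat (i + 1) + d (Suc i) * (\<phi> + d 1 + (\<Sum>k = 1..<i. d (Suc k))))
        (lact (x (Suc i)) (f (x 1 # map (\<lambda>i. x (Suc i)) [1..<i] @ map (\<lambda>i. x (Suc i)) [i+1..<n+2])))"
  have A: "?A (Suc i) (Suc j) = - ?A' i j" if "1 \<le> i" "i < j" "j \<le> n + 1" for i j
    using that m[of "i+1" j] m[of "j+1" "n+2"] m1[of i]
    by (simp add: sum.shift_bounds_Suc_ivl add.assoc signed_one_add del: upt_Suc sum.op_ivl_Suc)
  have B: "?B (Suc i) = - ?B' i" if "1 \<le> i" for i
    using that m[of "i+1" "n+2"] m1[of i] s1[of i]
    by (simp add: add.assoc signed_one_add del: upt_Suc sum.op_ivl_Suc)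
  have "(\<Sum>i = 1..Suc n. \<Sum>j = i+1..Suc n+1. ?A i j)
      = (\<Sum>j = 2..n+2. ?A 1 j) + (\<Sum>i = 1..n. \<Sum>j = i+1..n+1. ?A (Suc i) (Suc j))"
    by (rule split_sum)
  also have "(\<Sum>i = 1..n. \<Sum>j = i+1..n+1. ?A (Suc i) (Suc j)) = - (\<Sum>i = 1..n. \<Sum>j = i+1..n+1. ?A' i j)"
    unfolding sum_negf[symmetric] by (intro sum.cong refl A) auto
  finally have SA: "(\<Sum>i = 1..Suc n. \<Sum>j = i+1..Suc n+1. ?A i j)
      = (\<Sum>j = 2..n+2. ?A 1 j) - (\<Sum>i = 1..n. \<Sum>j = i+1..n+1. ?A' i j)" by simp
  have "(\<Sum>i = 1..Suc n. ?B i) = ?B 1 + (\<Sum>i = 1..n. ?B (Suc i))"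
    by (rule sum_first)
  also have "(\<Sum>i = 1..n. ?B (Suc i)) = - (\<Sum>i = 1..n. ?B' i)"
    unfolding sum_negf[symmetric] by (intro sum.cong refl B) auto
  finally have SB: "(\<Sum>i = 1..Suc n. ?B i) = ?B 1 - (\<Sum>i = 1..n. ?B' i)" by simp
  have C: "signed (of_nat (Suc n + 1)) (ract (f (map x [1..<Suc n + 1])) (x (Suc n + 1)))
      = - signed (of_nat (n + 1)) (ract (f (x 1 # map (\<lambda>i. x (Suc i)) [1..<n+1])) (x (Suc (n + 1))))"
    using m1[of "n+1"] by (simp add: add.assoc signed_one_add del: upt_Suc)
  have "(\<Sum>j = 2..n+2. ?A 1 j) = (\<Sum>j = 1..<n+2. signed (1 + d 1 * (\<Sum>k = 1..<j. d (Suc k)))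
        (f (map (\<lambda>i. x (Suc i)) [1..<j] @ br (x 1) (x (Suc j)) # map (\<lambda>i. x (Suc i)) [j+1..<n+2])))"
  proof -
    have summand: "?A 1 (Suc j) = signed (1 + d 1 * (\<Sum>k = 1..<j. d (Suc k)))
        (f (map (\<lambda>i. x (Suc i)) [1..<j] @ br (x 1) (x (Suc j)) # map (\<lambda>i. x (Suc i)) [j+1..<n+2]))"
      for j
      using m[of 1 j] m[of "j+1" "n+2"] sum.shift_bounds_Suc_ivl[of d 1 j]
      by (simp add: numeral_2_eq_2 del: upt_Suc sum.op_ivl_Suc)
    have "(\<Sum>j = 2..n+2. ?A 1 j) = (\<Sum>j = 1..n+1. ?A 1 (Suc j))"
      using sum.shift_bounds_cl_Suc_ivl[of "?A 1" 1 "n+1"]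
      by (simp only: one_add_one Suc_1 add_2_eq_Suc' Suc_eq_plus1[symmetric])
    also have "{1..n+1} = {1..<n+2}" by auto
    finally show ?thesis by (simp only: summand)
  qed
  moreover have "?B 1 = signed (d 1 * \<phi>) (lact (x 1) (f (map (\<lambda>i. x (Suc i)) [1..<n+2])))"
    using m[of 1 "n+2"] by (simp add: numeral_2_eq_2 del: upt_Suc)
  ultimately have l: "(\<Sum>j = 2..n+2. ?A 1 j) + ?B 1
      = lie \<phi> (x 1, d 1) (\<lambda>ps. f (map fst ps)) (map (\<lambda>i. (x (Suc i), d (Suc i))) [1..<n+2])"
    unfolding lie_upt by (simp add: graded_bracket_def comp_def add.commute del: upt_Suc sum.op_ivl_Suc)
  show ?thesis
    unfolding l[symmetric] coboundary_hom_def SA SB C by (simp add: algebra_simps del: upt_Suc)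
qed

text \<open>
  This holds for \<open>n = 0\<close> as well: both sums are then empty, and the right action alone is
  \<open>\<delta>\<^sup>0\<close>.
\<close>

theorem coboundary_hom_eq_cobd:
  "coboundary_hom br lact ract n \<phi> d f x
    = cobd \<phi> (\<lambda>ps. f (map fst ps)) (map (\<lambda>i. (x i, d i)) [1..<n+2])"
proof (induction n arbitrary: \<phi> d f x)
  case 0
  show ?case by (simp add: coboundary_hom_def signed_def numeral_2_eq_2)
next
  case (Suc n)
  have "map (\<lambda>i. (x i, d i)) [1..<Suc n + 2]
      = (x 1, d 1) # map (\<lambda>i. (x (Suc i), d (Suc i))) [1..<n+2]"
    by (simp add: upt_conv_Cons map_Suc_upt[symmetric] comp_def del: upt_Suc)
  then show ?case
    by (simp add: coboundary_hom_Suc Suc.IH cobd_Cons del: upt_Suc)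
qed

section \<open>From homogeneous data to arbitrary cochains\<close>

lemma hom_cochain_lift:
  assumes "f \<in> hom_cochains scaleL L scaleM M n \<phi>"
  shows "homogeneous_fun \<phi> (\<lambda>ps. f (map fst ps))" "slotwise_linear (\<lambda>ps. f (map fst ps))"
proof -
  have ml: "multilinear_map scaleL scaleM n f" using assms by (simp add: hom_cochains_def)
  have "f (map fst ps) \<in> M (\<phi> + sum_list (map snd ps))" if ps: "homogeneous_list ps" for ps
  proof (cases "length ps = n")
    case True
    have "\<forall>i<n. map fst ps ! i \<in> L (map snd ps ! i)"
      using ps True by (auto simp: homogeneous_list_def)
    then show ?thesis using assms True by (auto simp: hom_cochains_def)
  next
    case False
    then have "f (map fst ps) = 0" using ml by (simp add: multilinear_map_def)
    then show ?thesis by (simp add: M.subspace_0[OF M.subspace_grade])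
  qed
  then show "homogeneous_fun \<phi> (\<lambda>ps. f (map fst ps))" by (simp add: homogeneous_fun_def)
  have "f (xs @ (scaleL c u + scaleL c' v) # ys) = scaleM c (f (xs @ u # ys)) + scaleM c' (f (xs @ v # ys))"
    for xs ys c c' u v
  proof (cases "length xs + length ys + 1 = n")
    case True
    then have "Vector_Spaces.linear scaleL scaleM (\<lambda>w. f ((xs @ 0 # ys)[length xs := w]))"
      using ml by (simp add: multilinear_map_def del: list_update_length)
    then show ?thesis by (simp add: Vector_Spaces.linear_iff)
  next
    case False
    then show ?thesis using ml by (simp add: multilinear_map_def)
  qed
  then show "slotwise_linear (\<lambda>ps. f (map fst ps))" by (simp add: slotwise_linear_def)
qed

lemma component_L: "component L \<alpha> v \<in> L \<alpha> \<and> v - component L \<alpha> v \<in> L (\<alpha> + 1)"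
proof -
  obtain a b where ab: "a \<in> L 0" "b \<in> L 1" "v = a + b" using L.grades_span by blast
  have "component L \<alpha> v = (if \<alpha> = 0 then a else b)"
    by (rule component_eq[OF L.grades_disjoint L_diff]) (use ab in \<open>cases \<alpha>; simp\<close>)+
  then show ?thesis using ab by (cases \<alpha>) auto
qed

lemma component_L_sum: "component L 0 v + component L 1 v = v"
proof -
  have "component L 1 v = v - component L 0 v"
    by (rule component_eq[OF L.grades_disjoint L_diff]) (use component_L[of 0 v] in auto)
  then show ?thesis by simp
qed

lemma component_L_lincomb:
  "component L \<alpha> (scaleL c u + scaleL c' v)
    = scaleL c (component L \<alpha> u) + scaleL c' (component L \<alpha> v)"
proof (rule component_eq[OF L.grades_disjoint L_diff])
  have lc: "scaleL c a + scaleL c' b \<in> L \<beta>" if "a \<in> L \<beta>" "b \<in> L \<beta>" for a b \<beta>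
    using that L.subspace_add L.subspace_scale L.subspace_grade by blast
  show "scaleL c (component L \<alpha> u) + scaleL c' (component L \<alpha> v) \<in> L \<alpha>"
    using component_L by (auto intro: lc)
  have "scaleL c u + scaleL c' v - (scaleL c (component L \<alpha> u) + scaleL c' (component L \<alpha> v))
      = scaleL c (u - component L \<alpha> u) + scaleL c' (v - component L \<alpha> v)"
    by (simp add: L.scale_right_diff_distrib)
  then show "scaleL c u + scaleL c' v - (scaleL c (component L \<alpha> u) + scaleL c' (component L \<alpha> v))
      \<in> L (\<alpha> + 1)"
    using component_L by (auto intro: lc)
qed

definition components :: "bit list \<Rightarrow> 'l list \<Rightarrow> ('l \<times> bit) list" where
  "components es xs = map2 (\<lambda>e x. (component L e x, e)) es xs"

text \<open>
  The formula includes \<open>n = 0\<close>, where \<open>coboundary\<close> does not split into components: the sum over the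
  two degree lists reassembles the argument, and the sum of \<open>f0\<close> and \<open>f1\<close> reassembles the cochain.
  Every linearity statement below is read off from this formula.
\<close>

lemma coboundary_expand:
  assumes f: "f0 \<in> hom_cochains scaleL L scaleM M n 0" "f1 \<in> hom_cochains scaleL L scaleM M n 1"
    and len: "length xs = n + 1"
  shows "coboundary scaleL L br scaleM M lact ract n (f0 + f1) xs
    = (\<Sum>es | length es = n + 1. cobd 0 (\<lambda>ps. f0 (map fst ps)) (components es xs)
        + cobd 1 (\<lambda>ps. f1 (map fst ps)) (components es xs))"
proof (cases "n = 0")
  case True
  obtain x where x: "xs = [x]" using len True by (cases xs) auto
  have "{es :: bit list. length es = 1} = {[0], [1]}"
  proof (intro equalityI subsetI)
    fix es :: "bit list" assume "es \<in> {es. length es = 1}"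
    then obtain e where "es = [e]" by (cases es) auto
    then show "es \<in> {[0], [1]}" by (cases e) auto
  qed auto
  moreover have "ract (f0 [] + f1 []) x = ract (f0 []) (component L 0 x) + ract (f0 []) (component L 1 x)
      + (ract (f1 []) (component L 0 x) + ract (f1 []) (component L 1 x))"
    using ract_lincomb(1)[of 1 "f0 []" 1 "f1 []"]
      ract_lincomb(2)[of _ 1 "component L 0 x" 1 "component L 1 x"]
    by (simp add: component_L_sum)
  ultimately show ?thesis
    using True x by (simp add: coboundary_def components_def)
next
  case False
  have c: "component (hom_cochains scaleL L scaleM M n) 0 (f0 + f1) = f0"
    "component (hom_cochains scaleL L scaleM M n) 1 (f0 + f1) = f1"
    by (rule component_eq[OF hom_cochains_disjoint hom_cochains_diff]; use f in simp)+
  have m: "map (\<lambda>i. (component L (es ! (i - 1)) (xs ! (i - 1)), es ! (i - 1))) [1..<n + 2]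
      = components es xs" if "length es = n + 1" for es
    using that len by (intro nth_equalityI) (auto simp: components_def simp del: upt_Suc)
  show ?thesis
    using False len
    by (simp add: coboundary_def coboundary_hom_eq_cobd c sum.distrib del: upt_Suc)
      (intro arg_cong2[where f="(+)"] sum.cong refl; use m in \<open>simp del: upt_Suc\<close>)
qed

lemma coboundary_expand_homogeneous:
  assumes "f \<in> hom_cochains scaleL L scaleM M n \<phi>" and "length xs = n + 1"
  shows "coboundary scaleL L br scaleM M lact ract n f xs
    = (\<Sum>es | length es = n + 1. cobd \<phi> (\<lambda>ps. f (map fst ps)) (components es xs))"
proof -
  have "cobd \<psi> (\<lambda>ps. (0 :: 'l list \<Rightarrow> 'm) (map fst ps)) qs = 0" for \<psi> qs
    using cobd_lincomb[of \<psi> 0 "\<lambda>_. 0" 0 "\<lambda>_. 0" qs] by simp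
  then show ?thesis
    using coboundary_expand[of f n 0 xs] coboundary_expand[of 0 n f xs] hom_cochains_zero assms
    by (cases \<phi>) simp_all
qed

lemma coboundary_eq_cobd:
  assumes f: "f \<in> hom_cochains scaleL L scaleM M n \<phi>"
    and ps: "homogeneous_list ps" "length ps = n + 1"
  shows "coboundary scaleL L br scaleM M lact ract n f (map fst ps)
    = cobd \<phi> (\<lambda>ps. f (map fst ps)) ps"
proof (cases "n = 0")
  case True
  then show ?thesis using ps by (cases ps) (auto simp: coboundary_def)
next
  case False
  have "map (\<lambda>i. (fst (ps ! (i - 1)), snd (ps ! (i - 1)))) [1..<n + 2] = ps"
    using ps by (intro nth_equalityI) (auto simp del: upt_Suc)
  moreover have "map (\<lambda>i. (map fst ps ! (i - 1), map snd ps ! (i - 1))) [1..<n + 2]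
      = map (\<lambda>i. (fst (ps ! (i - 1)), snd (ps ! (i - 1)))) [1..<n + 2]"
    using ps by (intro map_cong refl) auto
  ultimately show ?thesis
    using coboundary_homogeneous[OF _ f, of "map fst ps" "map snd ps"] False ps
    by (auto simp: coboundary_hom_eq_cobd homogeneous_list_def simp del: upt_Suc)
qed

text \<open>
  Linearity in each argument uses the expansion over degree lists, since the arguments are
  arbitrary there; the degree is computed on homogeneous arguments, where a single term survives.
\<close>

lemma coboundary_hom_cochain:
  assumes f: "f \<in> hom_cochains scaleL L scaleM M n \<phi>"
  shows "coboundary scaleL L br scaleM M lact ract n f \<in> hom_cochains scaleL L scaleM M (n + 1) \<phi>"
proof -
  let ?\<delta>f = "coboundary scaleL L br scaleM M lact ract n f"
  let ?F = "\<lambda>ps. f (map fst ps)"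
  note lift = hom_cochain_lift[OF f]
  have lc: "?\<delta>f (xs[i := scaleL c u + scaleL c' v])
      = scaleM c (?\<delta>f (xs[i := u])) + scaleM c' (?\<delta>f (xs[i := v]))"
    if "length xs = n + 1" "i < n + 1" for xs i c c' u v
  proof -
    have split: "components es (xs[i := w]) = components (take i es) (take i xs) @
        (component L (es ! i) w, es ! i) # components (drop (Suc i) es) (drop (Suc i) xs)"
      if "length es = n + 1" for es w
    proof -
      have "components es (xs[i := w]) = components (take i es @ es ! i # drop (Suc i) es)
          (take i xs @ w # drop (Suc i) xs)"
        using that \<open>length xs = n + 1\<close> \<open>i < n + 1\<close> by (simp add: id_take_nth_drop[symmetric] upd_conv_take_nth_drop)
      then show ?thesis using that \<open>length xs = n + 1\<close> by (simp add: components_def)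
    qed
    show ?thesis
      using that
      by (simp add: coboundary_expand_homogeneous[OF f] M.scale_sum_right sum.distrib[symmetric])
        (rule sum.cong, use split in \<open>auto simp: component_L_lincomb
          slotwise_linearD[OF slotwise_linear_cobd[OF lift(2)]]\<close>)
  qed
  have "multilinear_map scaleL scaleM (n + 1) ?\<delta>f"
    unfolding multilinear_map_def Vector_Spaces.linear_iff
    using lc[of _ _ 1 _ 1] lc[of _ _ _ _ 0]
    by (auto simp: coboundary_def L.vector_space_axioms M.vector_space_axioms)
  moreover have "?\<delta>f xs \<in> M (\<phi> + sum_list ds)"
    if "length xs = n + 1" "length ds = n + 1" "\<forall>i<n+1. xs ! i \<in> L (ds ! i)" for xs ds
  proof -
    have "homogeneous_list (zip xs ds)" using that by (auto simp: homogeneous_list_def set_zip)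
    then show ?thesis
      using coboundary_eq_cobd[OF f, of "zip xs ds"] cobd_grade[OF lift(1), of "zip xs ds"] that by simp
  qed
  ultimately show ?thesis by (simp add: hom_cochains_def)
qed

text \<open>
  A multilinear map is determined by its values on homogeneous arguments, and on these both
  applications of the coboundary are given by \<open>cobd\<close>.
\<close>

lemma coboundary_coboundary_homogeneous:
  assumes f: "f \<in> hom_cochains scaleL L scaleM M n \<phi>"
  shows "coboundary scaleL L br scaleM M lact ract (n + 1)
    (coboundary scaleL L br scaleM M lact ract n f) = 0"
proof (rule multilinear_eq_0)
  let ?\<delta> = "coboundary scaleL L br scaleM M lact ract"
  note \<delta>f = coboundary_hom_cochain[OF f]
  show "multilinear_map scaleL scaleM (n + 1 + 1) (?\<delta> (n + 1) (?\<delta> n f))"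
    using coboundary_hom_cochain[OF \<delta>f] by (simp add: hom_cochains_def)
  fix xs ds
  assume *: "length xs = n + 1 + 1" "length ds = n + 1 + 1" "\<forall>i<n+1+1. xs ! i \<in> L (ds ! i)"
  let ?ps = "zip xs ds"
  have ps: "homogeneous_list ?ps" using * by (auto simp: homogeneous_list_def set_zip)
  have "?\<delta> (n + 1) (?\<delta> n f) xs = cobd \<phi> (\<lambda>qs. ?\<delta> n f (map fst qs)) ?ps"
    using coboundary_eq_cobd[OF \<delta>f ps] * by simp
  also have "\<dots> = cobd \<phi> (cobd \<phi> (\<lambda>qs. f (map fst qs))) ?ps"
    by (rule cobd_cong[OF _ ps]) (use * coboundary_eq_cobd[OF f] in simp)
  also have "\<dots> = 0" by (rule cobd_cobd[OF hom_cochain_lift[OF f] ps])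
  finally show "?\<delta> (n + 1) (?\<delta> n f) xs = 0" .
qed

lemma hom_cochains_lincomb:
  assumes "f \<in> hom_cochains scaleL L scaleM M n \<phi>" "g \<in> hom_cochains scaleL L scaleM M n \<phi>"
  shows "scale_fun scaleM c f + scale_fun scaleM c' g \<in> hom_cochains scaleL L scaleM M n \<phi>"
proof -
  have "scaleM c u + scaleM c' v \<in> M \<beta>" if "u \<in> M \<beta>" "v \<in> M \<beta>" for u v \<beta>
    using that M.subspace_add M.subspace_scale M.subspace_grade by blast
  then show ?thesis using assms
    by (auto simp: hom_cochains_def multilinear_map_def Vector_Spaces.linear_iff scale_fun_def
        M.scale_right_distrib M.scale_left_commute mult.commute)
qed

lemma module_scale_fun: "module (scale_fun scaleM :: 'k \<Rightarrow> ('x \<Rightarrow> 'm) \<Rightarrow> 'x \<Rightarrow> 'm)"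
  by unfold_locales
    (auto simp: scale_fun_def fun_eq_iff M.scale_right_distrib M.scale_left_distrib)

text \<open>
  A linear combination of cochains is taken separately in the two degrees, so the expansion
  applies to it with the combined components.
\<close>

lemma cochains_lincomb:
  assumes "f \<in> cochains scaleL L scaleM M n" "g \<in> cochains scaleL L scaleM M n"
  shows "scale_fun scaleM c f + scale_fun scaleM c' g \<in> cochains scaleL L scaleM M n"
    and "coboundary scaleL L br scaleM M lact ract n (scale_fun scaleM c f + scale_fun scaleM c' g)
      = scale_fun scaleM c (coboundary scaleL L br scaleM M lact ract n f)
        + scale_fun scaleM c' (coboundary scaleL L br scaleM M lact ract n g)"
proof -
  obtain f0 f1 where f: "f0 \<in> hom_cochains scaleL L scaleM M n 0" "f1 \<in> hom_cochains scaleL L scaleM M n 1"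
    "f = f0 + f1" using assms(1) by (auto simp: cochains_def)
  obtain g0 g1 where g: "g0 \<in> hom_cochains scaleL L scaleM M n 0" "g1 \<in> hom_cochains scaleL L scaleM M n 1"
    "g = g0 + g1" using assms(2) by (auto simp: cochains_def)
  define h0 where "h0 = scale_fun scaleM c f0 + scale_fun scaleM c' g0"
  define h1 where "h1 = scale_fun scaleM c f1 + scale_fun scaleM c' g1"
  have h: "h0 \<in> hom_cochains scaleL L scaleM M n 0" "h1 \<in> hom_cochains scaleL L scaleM M n 1"
    using f g by (simp_all add: h0_def h1_def hom_cochains_lincomb)
  have fg: "scale_fun scaleM c f + scale_fun scaleM c' g = h0 + h1"
    by (simp add: fun_eq_iff f g h0_def h1_def scale_fun_def M.scale_right_distrib)
  show "scale_fun scaleM c f + scale_fun scaleM c' g \<in> cochains scaleL L scaleM M n"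
    using fg h by (auto simp: cochains_def)
  show "coboundary scaleL L br scaleM M lact ract n (scale_fun scaleM c f + scale_fun scaleM c' g)
      = scale_fun scaleM c (coboundary scaleL L br scaleM M lact ract n f)
        + scale_fun scaleM c' (coboundary scaleL L br scaleM M lact ract n g)"
  proof
    fix xs
    have h_lincomb: "cobd \<psi> (\<lambda>ps. h0 (map fst ps)) qs
        = scaleM c (cobd \<psi> (\<lambda>ps. f0 (map fst ps)) qs) + scaleM c' (cobd \<psi> (\<lambda>ps. g0 (map fst ps)) qs)"
      "cobd \<psi> (\<lambda>ps. h1 (map fst ps)) qs
        = scaleM c (cobd \<psi> (\<lambda>ps. f1 (map fst ps)) qs) + scaleM c' (cobd \<psi> (\<lambda>ps. g1 (map fst ps)) qs)"
      for \<psi> qs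
      by (simp_all add: h0_def h1_def scale_fun_def cobd_lincomb)
    show "coboundary scaleL L br scaleM M lact ract n (scale_fun scaleM c f + scale_fun scaleM c' g) xs
      = (scale_fun scaleM c (coboundary scaleL L br scaleM M lact ract n f)
        + scale_fun scaleM c' (coboundary scaleL L br scaleM M lact ract n g)) xs"
    proof (cases "length xs = n + 1")
      case True
      note expand = coboundary_expand[OF f(1,2) True] coboundary_expand[OF g(1,2) True]
        coboundary_expand[OF h True]
      show ?thesis
        unfolding fg unfolding f(3) g(3)
        by (simp add: scale_fun_def expand M.scale_sum_right sum.distrib[symmetric])
          (simp add: h_lincomb M.scale_right_distrib add.assoc add.left_commute)
    qed (simp add: coboundary_def scale_fun_def)
  qed
qed

lemma coboundary_cochain:
  assumes "f \<in> cochains scaleL L scaleM M n"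
  shows "coboundary scaleL L br scaleM M lact ract n f \<in> cochains scaleL L scaleM M (n + 1)"
    and "coboundary scaleL L br scaleM M lact ract (n + 1)
      (coboundary scaleL L br scaleM M lact ract n f) = 0"
proof -
  let ?\<delta> = "coboundary scaleL L br scaleM M lact ract"
  have hom: "g \<in> cochains scaleL L scaleM M k" if "g \<in> hom_cochains scaleL L scaleM M k \<phi>" for g k \<phi>
  proof -
    have "g = g + 0" "g = 0 + g" by simp_all
    then show ?thesis using that hom_cochains_zero unfolding cochains_def
      by (cases \<phi>) blast+
  qed
  have add: "?\<delta> k (g + h) = ?\<delta> k g + ?\<delta> k h"
    if "g \<in> cochains scaleL L scaleM M k" "h \<in> cochains scaleL L scaleM M k" for g h k
    using cochains_lincomb(2)[OF that, of 1 1] by (simp add: scale_fun_def)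
  obtain f0 f1 where f: "f0 \<in> hom_cochains scaleL L scaleM M n 0" "f1 \<in> hom_cochains scaleL L scaleM M n 1"
    "f = f0 + f1" using assms by (auto simp: cochains_def)
  note \<delta>f = coboundary_hom_cochain[OF f(1)] coboundary_hom_cochain[OF f(2)]
  have eq: "?\<delta> n f = ?\<delta> n f0 + ?\<delta> n f1" using f by (simp add: add[OF hom hom])
  then show "?\<delta> n f \<in> cochains scaleL L scaleM M (n + 1)" using \<delta>f unfolding cochains_def by blast
  show "?\<delta> (n + 1) (?\<delta> n f) = 0"
    unfolding eq add[OF hom[OF \<delta>f(1)] hom[OF \<delta>f(2)]]
    using coboundary_coboundary_homogeneous f by simp
qed

section \<open>The cochain complex\<close>

lemma subspace_cochains:
  "module.subspace (scale_fun scaleM) (cochains scaleL L scaleM M n)"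
proof -
  have "0 \<in> cochains scaleL L scaleM M n"
    using hom_cochains_zero unfolding cochains_def by (metis (mono_tags, lifting) add.right_neutral mem_Collect_eq)
  then show ?thesis
    unfolding module.subspace_def[OF module_scale_fun]
    using cochains_lincomb(1)[where c=1 and c'=1] cochains_lincomb(1)[where c'=0]
    by (simp add: scale_fun_def plus_fun_def)
qed

lemma linear_coboundary:
  "linear_map_between (scale_fun scaleM) (cochains scaleL L scaleM M n)
    (cochains scaleL L scaleM M (n + 1)) (coboundary scaleL L br scaleM M lact ract n)"
  unfolding linear_map_between_def
  using subspace_cochains coboundary_cochain(1)
    cochains_lincomb(2)[where c=1 and c'=1] cochains_lincomb(2)[where c'=0]
  by (auto simp: scale_fun_def plus_fun_def)

end

theorem theorem3p1:
  fixes scaleL :: "'k::field \<Rightarrow> 'l::ab_group_add \<Rightarrow> 'l" and L :: "bit \<Rightarrow> 'l set"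
    and br :: "'l \<Rightarrow> 'l \<Rightarrow> 'l"
    and scaleM :: "'k \<Rightarrow> 'm::ab_group_add \<Rightarrow> 'm" and M :: "bit \<Rightarrow> 'm set"
    and lact :: "'l \<Rightarrow> 'm \<Rightarrow> 'm" and ract :: "'m \<Rightarrow> 'l \<Rightarrow> 'm"
  defines "C \<equiv> cochains scaleL L scaleM M"
    and "\<delta> \<equiv> coboundary scaleL L br scaleM M lact ract"
  assumes "leibniz_superalgebra scaleL L br"
    and "leibniz_supermodule scaleL L br scaleM M lact ract"
  shows "(\<forall>n. linear_map_between (scale_fun scaleM) (C n) (C (n + 1)) (\<delta> n)) \<and>
    (\<forall>n. \<forall>f\<in>C n. \<delta> (n + 1) (\<delta> n f) = 0)"
proof -
  interpret leibniz_supermodule scaleL L br scaleM M lact ract by fact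
  show ?thesis
    unfolding C_def \<delta>_def using linear_coboundary coboundary_cochain(2) by blast
qed

end
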